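(* If $\mathfrak{p}>\omega_1$, then there are no barely independent families over $\omega_1$.
   Context: Notation: for $A\subseteq\omega_1$, put $A^0=A$ and $A^1=\omega_1\setminus A$. For a family $\mathcal{A}$ of subsets of $\omega_1$ and $h:\mathcal{A}\to 2=\{0,1\}$, put $\mathcal{A}^h=\{A^{h(A)} : A\in\mathcal{A}\}$. Definition: a family $\mathcal{I}$ of subsets of $\omega_1$, each of size $\omega_1$, is barely independent (over $\omega_1$) if $\mathcal{I}$ is infinite and (i) $|\bigcap\mathcal{A}^h|=\omega_1$ for every finite $\mathcal{A}\subseteq\mathcal{I}$ and every $h:\mathcal{A}\to 2$ (the empty intersection being $\omega_1$); (ii) $|\bigcap\mathcal{A}^h|<\omega_1$ for every countably infinite $\mathcal{A}\subseteq\mathcal{I}$ and every $h:\mathcal{A}\to 2$. $\mathfrak{p}$ is the pseudointersection number: the least cardinality of a family $\mathcal{F}$ of infinite subsets of $\omega$ such that every finite subfamily of $\mathcal{F}$ has infinite intersection but there is no infinite $B\subseteq\omega$ with $B\setminus F$ finite for all $F\in\mathcal{F}$. *)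

theory Defs
  imports "HOL-Library.Countable_Set" "HOL-Library.Infinite_Set"
begin

unbundle cardinal_syntax

abbreviation omega1 :: "nat set rel" where
  "omega1 \<equiv> cardSuc natLeq"

text \<open>The underlying set of the cardinal \<open>\<omega>\<^sub>1\<close>; cardinals are initial well-orders,
  and a subset of \<open>\<omega>\<^sub>1\<close> is a subset of the field of that well-order.\<close>

abbreviation Omega1 :: "nat set set" where
  "Omega1 \<equiv> Field omega1"

text \<open>The set \<open>A\<^sup>i\<close>; the value \<open>0\<close> of the index is \<^term>\<open>False\<close>, the value \<open>1\<close> is \<^term>\<open>True\<close>.\<close>

definition side :: "nat set set \<Rightarrow> bool \<Rightarrow> nat set set" where
  "side A i = (if i then Omega1 - A else A)"

text \<open>The family \<open>\<A>\<^sup>h\<close>, which depends only on the restriction of \<open>h\<close> to \<open>\<A>\<close>.\<close>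

definition sides :: "nat set set set \<Rightarrow> (nat set set \<Rightarrow> bool) \<Rightarrow> nat set set set" where
  "sides \<A> h = {side A (h A) | A. A \<in> \<A>}"

text \<open>Intersecting with \<^term>\<open>Omega1\<close> only matters for the empty family, whose
  intersection is \<open>\<omega>\<^sub>1\<close> and not the whole type.\<close>

definition barely_independent :: "nat set set set \<Rightarrow> bool" where
  "barely_independent \<I> \<longleftrightarrow>
     (\<forall>A\<in>\<I>. A \<subseteq> Omega1 \<and> |A| =o omega1) \<and>
     infinite \<I> \<and>
     (\<forall>\<A> h. \<A> \<subseteq> \<I> \<and> finite \<A> \<longrightarrow> |Omega1 \<inter> \<Inter> (sides \<A> h)| =o omega1) \<and>
     (\<forall>\<A> h. \<A> \<subseteq> \<I> \<and> countable \<A> \<and> infinite \<A> \<longrightarrow> |Omega1 \<inter> \<Inter> (sides \<A> h)| <o omega1)"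

definition strong_fip :: "nat set set \<Rightarrow> bool" where
  "strong_fip \<F> \<longleftrightarrow>
     (\<forall>F\<in>\<F>. infinite F) \<and> (\<forall>\<G>. \<G> \<subseteq> \<F> \<and> finite \<G> \<longrightarrow> infinite (\<Inter>\<G>))"

definition pseudointersection :: "nat set \<Rightarrow> nat set set \<Rightarrow> bool" where
  "pseudointersection B \<F> \<longleftrightarrow> infinite B \<and> (\<forall>F\<in>\<F>. finite (B - F))"

definition pseudointersection_witness :: "nat set set \<Rightarrow> bool" where
  "pseudointersection_witness \<F> \<longleftrightarrow> strong_fip \<F> \<and> \<not> (\<exists>B. pseudointersection B \<F>)"

text \<open>A least element of the class of cardinals of such families. It exists and is
  unique up to order isomorphism, see \<open>pseudointersection_number_attained\<close> and
  \<open>pseudointersection_number_least\<close> below.\<close>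

definition pseudointersection_number :: "nat set rel" where
  "pseudointersection_number =
     (SOME r. r \<in> card_of ` Collect pseudointersection_witness \<and>
       (\<forall>r' \<in> card_of ` Collect pseudointersection_witness. r \<le>o r'))"

lemma pseudointersection_witness_exists: "\<exists>\<F>. pseudointersection_witness \<F>"
proof -
  have "\<exists>M\<in>Collect strong_fip. \<forall>X\<in>Collect strong_fip. M \<subseteq> X \<longrightarrow> X = M"
  proof (rule subset_Zorn_nonempty)
    have "strong_fip {}"
      by (simp add: strong_fip_def)
    then show "Collect strong_fip \<noteq> {}"
      by blast
  next
    fix \<C> assume ne: "\<C> \<noteq> {}" and ch: "subset.chain (Collect strong_fip) \<C>"
    have "infinite (\<Inter>\<G>)" if G: "\<G> \<subseteq> \<Union>\<C>" "finite \<G>" for \<G>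
    proof -
      obtain C where "C \<in> \<C>" "\<G> \<subseteq> C"
        using finite_subset_Union_chain[OF G(2) G(1) ne ch] by blast
      moreover have "strong_fip C"
        using \<open>C \<in> \<C>\<close> ch by (auto simp: subset.chain_def)
      ultimately show ?thesis
        using G(2) by (auto simp: strong_fip_def)
    qed
    moreover have "infinite F" if "F \<in> \<Union>\<C>" for F
      using that ch by (auto simp: subset.chain_def strong_fip_def)
    ultimately show "\<Union>\<C> \<in> Collect strong_fip"
      by (simp add: strong_fip_def)
  qed
  then obtain M where M: "strong_fip M"
    and max: "\<And>X. strong_fip X \<Longrightarrow> M \<subseteq> X \<Longrightarrow> X = M"
    by auto
  have mem: "C \<in> M" if "infinite C" "pseudointersection C M" for C
  proof -
    have "strong_fip (insert C M)"
      unfolding strong_fip_def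
    proof (intro conjI ballI allI impI)
      show "infinite F" if "F \<in> insert C M" for F
        using that \<open>infinite C\<close> M by (auto simp: strong_fip_def)
    next
      fix \<G> assume G: "\<G> \<subseteq> insert C M \<and> finite \<G>"
      have fin: "finite (\<Union>F\<in>\<G> - {C}. C - F)"
        by (rule finite_UN_I)
          (use G \<open>pseudointersection C M\<close> in \<open>auto simp: pseudointersection_def\<close>)
      have "C - (\<Union>F\<in>\<G> - {C}. C - F) \<subseteq> \<Inter>\<G>"
        by auto
      then show "infinite (\<Inter>\<G>)"
        using Diff_infinite_finite[OF fin \<open>infinite C\<close>] infinite_super by blast
    qed
    then show ?thesis
      using max by blast
  qed
  have "\<not> pseudointersection B M" for B
  proof
    assume B: "pseudointersection B M"
    then have "infinite B"
      by (simp add: pseudointersection_def)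
    then obtain C D where CD: "C \<subseteq> B" "D \<subseteq> B" "infinite C" "infinite D" "C \<inter> D = {}"
      by (metis infinite_split)
    have "pseudointersection X M" if "X \<subseteq> B" "infinite X" for X
      using B that unfolding pseudointersection_def
      by (meson Diff_mono finite_subset order_refl)
    then have "{C, D} \<subseteq> M"
      using CD mem by auto
    then have "infinite (\<Inter>{C, D})"
      using M unfolding strong_fip_def by (metis finite.emptyI finite.insertI)
    then show False
      using CD by simp
  qed
  then show ?thesis
    using M by (auto simp: pseudointersection_witness_def)
qed

lemma pseudointersection_number_spec:
  "pseudointersection_number \<in> card_of ` Collect pseudointersection_witness \<and>
   (\<forall>r' \<in> card_of ` Collect pseudointersection_witness. pseudointersection_number \<le>o r')"
proof -
  let ?R = "card_of ` Collect pseudointersection_witness :: nat set rel set"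
  have "\<exists>r\<in>?R. \<forall>r'\<in>?R. r \<le>o r'"
    by (rule exists_minim_Card_order) (use pseudointersection_witness_exists in \<open>auto simp: card_of_Card_order\<close>)
  then show ?thesis
    unfolding pseudointersection_number_def unfolding Bex_def by (rule someI_ex)
qed

lemma pseudointersection_number_attained:
  "\<exists>\<F>. pseudointersection_witness \<F> \<and> pseudointersection_number = |\<F>|"
  using pseudointersection_number_spec by auto

lemma pseudointersection_number_least:
  "pseudointersection_witness \<F> \<Longrightarrow> pseudointersection_number \<le>o |\<F>|"
  using pseudointersection_number_spec by auto

end

theory Submission
  imports Defs "HOL-Library.Countable_Set_Type"
begin

text \<open>Enumerate distinct members \<open>a\<^sub>0, a\<^sub>1, \<dots>\<close> of the family and let \<open>X\<^sub>\<alpha> = {n. \<alpha> \<in> a\<^sub>n}\<close> for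
  \<open>\<alpha> < \<omega>\<^sub>1\<close>. Since \<open>\<omega>\<^sub>1 < \<pp>\<close> and \<open>\<pp>\<close> is at most the splitting number, some infinite \<open>B \<subseteq> \<omega>\<close> is
  split by no \<open>X\<^sub>\<alpha>\<close>: take a pseudointersection of the sets \<open>X\<^sub>\<alpha>\<close> or their complements, whichever
  lie in a fixed free ultrafilter. By pigeonhole, uncountably many \<open>\<alpha>\<close> lie on the same side of all
  \<open>a\<^sub>m\<close> with \<open>m \<in> B\<close> and \<open>m \<ge> n\<close>, for a single \<open>n\<close>, which contradicts (ii).\<close>

lemma strong_fip_iff: "strong_fip \<F> \<longleftrightarrow> (\<forall>\<G>. \<G> \<subseteq> \<F> \<and> finite \<G> \<longrightarrow> infinite (\<Inter>\<G>))"
proof -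
  have "infinite F" if "\<And>\<G>. \<G> \<subseteq> \<F> \<Longrightarrow> finite \<G> \<Longrightarrow> infinite (\<Inter>\<G>)" "F \<in> \<F>" for F
    using that(1)[of "{F}"] that(2) by simp
  then show ?thesis
    unfolding strong_fip_def by blast
qed

text \<open>Isolates the new set \<open>X\<close>, so that a failed extension of \<open>\<F>\<close>
  yields a finite \<open>\<G>\<close> within \<open>\<F>\<close> whose intersection meets
  \<open>X\<close> in a finite set.\<close>

lemma strong_fip_insert_iff:
  "strong_fip (insert X \<F>) \<longleftrightarrow> (\<forall>\<G>. \<G> \<subseteq> \<F> \<and> finite \<G> \<longrightarrow> infinite (X \<inter> \<Inter>\<G>))"
  (is "?L \<longleftrightarrow> ?R")
proof
  assume ?L
  show ?R
  proof (intro allI impI)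
    fix \<G> assume "\<G> \<subseteq> \<F> \<and> finite \<G>"
    then have "insert X \<G> \<subseteq> insert X \<F> \<and> finite (insert X \<G>)"
      by auto
    then have "infinite (\<Inter>(insert X \<G>))"
      using \<open>?L\<close> unfolding strong_fip_iff by blast
    then show "infinite (X \<inter> \<Inter>\<G>)"
      by simp
  qed
next
  assume R: ?R
  show ?L
    unfolding strong_fip_iff
  proof (intro allI impI)
    fix \<G> assume "\<G> \<subseteq> insert X \<F> \<and> finite \<G>"
    then have "\<G> - {X} \<subseteq> \<F> \<and> finite (\<G> - {X})"
      by auto
    then have "infinite (X \<inter> \<Inter>(\<G> - {X}))"
      using R by blast
    moreover have "X \<inter> \<Inter>(\<G> - {X}) \<subseteq> \<Inter>\<G>"
      by blast
    ultimately show "infinite (\<Inter>\<G>)"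
      using infinite_super by blast
  qed
qed

text \<open>By Zorn, a maximal family with \<open>strong_fip\<close> decides every set. The two
  properties already give a free ultrafilter: a superset or an intersection of members cannot have
  its complement in \<open>\<U>\<close>, and no member is finite.\<close>

lemma free_ultrafilter_exists: "\<exists>\<U>. strong_fip \<U> \<and> (\<forall>X. X \<in> \<U> \<or> - X \<in> \<U>)"
proof -
  have "\<exists>M\<in>Collect strong_fip. \<forall>X\<in>Collect strong_fip. M \<subseteq> X \<longrightarrow> X = M"
  proof (rule subset_Zorn_nonempty)
    show "Collect strong_fip \<noteq> {}"
      by (auto simp: strong_fip_def intro!: exI[of _ "{}"])
  next
    fix \<C> assume ne: "\<C> \<noteq> {}" and ch: "subset.chain (Collect strong_fip) \<C>"
    have "infinite (\<Inter>\<G>)" if G: "\<G> \<subseteq> \<Union>\<C>" "finite \<G>" for \<G>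
    proof -
      obtain C where "C \<in> \<C>" "\<G> \<subseteq> C"
        using finite_subset_Union_chain[OF G(2,1) ne ch] by blast
      moreover have "strong_fip C"
        using \<open>C \<in> \<C>\<close> ch by (auto simp: subset.chain_def)
      ultimately show ?thesis
        using G(2) by (auto simp: strong_fip_iff)
    qed
    then show "\<Union>\<C> \<in> Collect strong_fip"
      by (simp add: strong_fip_iff)
  qed
  then obtain M where M: "strong_fip M" and max: "\<And>X. strong_fip X \<Longrightarrow> M \<subseteq> X \<Longrightarrow> X = M"
    by auto
  have "X \<in> M \<or> - X \<in> M" for X
  proof (rule ccontr)
    assume "\<not> (X \<in> M \<or> - X \<in> M)"
    then have "\<not> strong_fip (insert X M)" "\<not> strong_fip (insert (- X) M)"
      using max by blast+
    then obtain \<G> \<H> where *: "\<G> \<subseteq> M" "finite \<G>" "finite (X \<inter> \<Inter>\<G>)"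
        "\<H> \<subseteq> M" "finite \<H>" "finite (- X \<inter> \<Inter>\<H>)"
      unfolding strong_fip_insert_iff by blast
    \<comment> \<open>If neither \<open>X\<close> nor its complement can be added, the two finite
      obstructions together contradict \<open>strong_fip M\<close>.\<close>
    have "\<Inter>(\<G> \<union> \<H>) \<subseteq> (X \<inter> \<Inter>\<G>) \<union> (- X \<inter> \<Inter>\<H>)"
      by blast
    then have "finite (\<Inter>(\<G> \<union> \<H>))"
      using * by (meson finite_UnI finite_subset)
    then show False
      using M * unfolding strong_fip_iff by (meson Un_least finite_UnI)
  qed
  with M show ?thesis
    by blast
qed

lemma unsplit_set_exists:
  fixes X :: "'a \<Rightarrow> nat set"
  assumes "|K| <o pseudointersection_number"
  shows "\<exists>B. infinite B \<and> (\<forall>k\<in>K. finite (B - X k) \<or> finite (B \<inter> X k))"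
proof -
  obtain \<U> where U: "strong_fip \<U>" "\<And>Y. Y \<in> \<U> \<or> - Y \<in> \<U>"
    using free_ultrafilter_exists by blast
  define f where "f k = (if X k \<in> \<U> then X k else - X k)" for k
  have "f ` K \<subseteq> \<U>"
    using U(2) by (auto simp: f_def)
  then have "strong_fip (f ` K)"
    using U(1) by (auto simp: strong_fip_iff)
  \<comment> \<open>The image has at most \<open>|K|\<close> members, fewer than the least size of a
    witness.\<close>
  moreover have "\<not> pseudointersection_witness (f ` K)"
    using pseudointersection_number_least[of "f ` K"] ordLeq_transitive[OF _ card_of_image]
      not_ordLess_ordLeq[OF assms]
    by blast
  ultimately obtain B where "infinite B" and B: "\<forall>k\<in>K. finite (B - f k)"
    unfolding pseudointersection_witness_def pseudointersection_def by auto
  moreover have "finite (B - X k) \<or> finite (B \<inter> X k)" if "k \<in> K" for k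
    using B that by (auto simp: f_def Diff_eq split: if_splits)
  ultimately show ?thesis
    by blast
qed

lemma countable_if_less_omega1:
  assumes "|A| <o omega1"
  shows "countable A"
proof -
  have "|A| \<le>o natLeq"
    using assms by (simp add: cardSuc_ordLeq_ordLess[OF natLeq_Card_order card_of_Card_order])
  then show ?thesis
    by (simp add: countable_card_le_natLeq)
qed

lemma card_of_Omega1: "|Omega1| =o omega1"
  by (rule card_of_Field_ordIso[OF cardSuc_Card_order[OF natLeq_Card_order]])

lemma uncountable_Omega1: "uncountable Omega1"
proof
  assume "countable Omega1"
  then have "omega1 \<le>o natLeq"
    using card_of_Omega1 by (meson countable_card_le_natLeq ordIso_ordLeq_trans ordIso_symmetric)
  then show False
    using cardSuc_greater natLeq_Card_order not_ordLess_ordLeq by blast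
qed

theorem corollary4p10:
  assumes "omega1 <o pseudointersection_number"
  shows "\<not> (\<exists>\<I>. barely_independent \<I>)"
proof
  assume "\<exists>\<I>. barely_independent \<I>"
  then obtain \<I> where I: "barely_independent \<I>"
    by blast
  have ii: "|Omega1 \<inter> \<Inter>(sides \<A> h)| <o omega1"
    if "\<A> \<subseteq> \<I>" "countable \<A>" "infinite \<A>" for \<A> h
    using I that by (simp add: barely_independent_def)
  have "infinite \<I>"
    using I by (simp add: barely_independent_def)
  then obtain a :: "nat \<Rightarrow> nat set set" where a: "inj a" "range a \<subseteq> \<I>"
    using infinite_countable_subset by blast
  obtain B where "infinite B"
    and B: "\<And>\<alpha>. \<alpha> \<in> Omega1 \<Longrightarrow> finite (B - {n. \<alpha> \<in> a n}) \<or> finite (B \<inter> {n. \<alpha> \<in> a n})"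
    using unsplit_set_exists[OF ordIso_ordLess_trans[OF card_of_Omega1 assms],
        of "\<lambda>\<alpha>. {n. \<alpha> \<in> a n}"]
    by blast
  \<comment> \<open>For fixed \<open>i\<close> and \<open>n\<close> this is the intersection in (ii)
    for a constant \<open>h\<close>; injectivity of \<open>a\<close> keeps the subfamily
    infinite.\<close>
  define S where "S i n = {\<alpha> \<in> Omega1. \<forall>m \<in> B \<inter> {n..}. \<alpha> \<in> side (a m) i}" for i n
  have "countable (S i n)" for i n
  proof (rule countable_if_less_omega1)
    let ?\<A> = "a ` (B \<inter> {n..})"
    have "infinite (B \<inter> {n..})"
      using Diff_infinite_finite[OF finite_lessThan \<open>infinite B\<close>]
      by (simp add: Diff_eq Compl_lessThan)
    then have "infinite ?\<A>"
      using a(1) by (meson finite_imageD inj_on_subset subset_UNIV)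
    then have "|Omega1 \<inter> \<Inter>(sides ?\<A> (\<lambda>_. i))| <o omega1"
      using a(2) by (intro ii) auto
    moreover have "Omega1 \<inter> \<Inter>(sides ?\<A> (\<lambda>_. i)) = S i n"
      by (auto simp: S_def sides_def)
    ultimately show "|S i n| <o omega1"
      by simp
  qed
  \<comment> \<open>The pigeonhole step: countably many countable sets cannot cover
    \<omega>1.\<close>
  moreover have "Omega1 \<subseteq> (\<Union>i. \<Union>n. S i n)"
  proof
    fix \<alpha> assume \<alpha>: "\<alpha> \<in> Omega1"
    \<comment> \<open>As \<open>B\<close> is unsplit, for one side the indices where \<alpha> is off
      that side are finitely many; \<open>n\<close> is chosen above all of them.\<close>
    have "{m \<in> B. \<alpha> \<notin> side (a m) False} = B - {n. \<alpha> \<in> a n}"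
      and "{m \<in> B. \<alpha> \<notin> side (a m) True} = B \<inter> {n. \<alpha> \<in> a n}"
      using \<alpha> by (auto simp: side_def)
    then obtain i where "finite {m \<in> B. \<alpha> \<notin> side (a m) i}"
      using B[OF \<alpha>] by metis
    then obtain n where "\<forall>m \<in> {m \<in> B. \<alpha> \<notin> side (a m) i}. m < n"
      unfolding finite_nat_set_iff_bounded by (rule exE)
    then have "\<alpha> \<in> S i n"
      using \<alpha> by (fastforce simp: S_def)
    then show "\<alpha> \<in> (\<Union>i. \<Union>n. S i n)"
      by blast
  qed
  ultimately have "countable Omega1"
    by (auto intro: countable_subset)
  then show False
    using uncountable_Omega1 by blast
qed

end
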